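(* Let $\nu_0=n-\nu_1-\cdots-\nu_p$ and write $\mathcal R_0(\lambda_{0,k})=\mathcal R(\lambda_{0,k})$ for $k\in\{1,\ldots,\nu_0\}$. Problem 1A (stated in the context) is solvable if and only if $$\dim\Big(\sum_{(i,j)\in P}\mathcal R_i(\lambda_{i,j})\Big)\ge \operatorname{card} P$$ for all $P$ in the power set $2^I$, where $I=\{(0,1),\ldots,(0,\nu_0),(1,1),\ldots,(1,\nu_1),\ldots,(p,1),\ldots,(p,\nu_p)\}$.
   Context: System: $\Sigma=(A,B,C,D)$ is $\mathcal D x=Ax+Bu$, $y=Cx+Du$, $x(t)\in\mathbb R^n$, $u(t)\in\mathbb R^m$, $y(t)\in\mathbb R^p$, real matrices; $\mathcal D x=\dot x$ (continuous time) or $x(t+1)$ (discrete time). $\mathbb C_g$ is the open left half-plane (continuous) or open unit disc (discrete), $\mathbb R_g=\mathbb C_g\cap\mathbb R$. $\mathcal Z$ is the set of invariant zeros of $\Sigma$: those $\lambda\in\mathbb C$ at which the rank of $\begin{bmatrix}A-\lambda I&B\\C&D\end{bmatrix}$ is below its normal rank; minimum-phase zeros are those in $\mathbb C_g$. Standing assumptions: $\Sigma$ is right invertible (that matrix pencil has full row rank for all but finitely many $\lambda$), stabilizable, with no invariant zero at $0$ (continuous) or $1$ (discrete); algebraic and geometric multiplicities of each minimum-phase invariant zero coincide; no Jordan chains are allowed in the closed loop ($A+BF$ diagonalizable); in this part all closed-loop eigenvalues considered and all minimum-phase invariant zeros are real. Control: $u=Fx+Gr$, $F$ real with $\sigma(A+BF)\subset\mathbb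 C_g$, $G$ a right inverse of the closed-loop static gain. For constant $r$, $\epsilon=y-r$ satisfies $\mathcal D\xi=(A+BF)\xi$, $\epsilon=(C+DF)\xi$. State-to-output decoupling: for any initial condition, $\epsilon_i(t)=\sum_{j=1}^{\nu_i}\beta_{i,j}e^{\lambda_{i,j}t}$ (resp. $\sum_j\beta_{i,j}\lambda_{i,j}^t$), $i=1,\ldots,p$, where the $\lambda_{i,j}$ are the observable closed-loop eigenvalues and the coefficients $\beta_{i,j}$ can be made arbitrary by choice of $\xi(0)$. That is, $A+BF$ has a basis of eigenvectors $v_{0,1},\ldots,v_{0,\nu_0},v_{1,1},\ldots,v_{p,\nu_p}$ with eigenvalues $\lambda_{i,j}$ such that $(C+DF)v_{0,j}=0$ and $(C+DF)v_{i,j}$ is a nonzero multiple of the $i$-th canonical vector $e_i\in\mathbb R^p$ for $i\ge1$; the $\lambda_{i,j}$ ($1\le j\le\nu_i$) are the eigenvalues observable from $\epsilon_i$ and the $\lambda_{0,j}$ the unobservable ones (all counted with multiplicity). Problem 1A: given nonnegative integers $\nu_1,\ldots,\nu_p$ with $\nu_0=n-\sum_i\nu_i\ge0$, and assigned $\lambda_{i,j}\in\mathbb R_g\setminus\mathcal Z$ ($i=1,\ldots,p$, $j=1,\ldots,\nu_i$) and $\lambda_{0,j}\in\mathbb R_g$ ($j=1,\ldots,\nu_0$), find $F,G$ such that: (1) $y(t)\to\bar r$ for every constant reference $r(t)=\bar r$; (2) state-to-output decoupling is achieved; (3) from each $\epsilon_i$ exactly $\nu_i$ eigenvalues are observable and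 they are not invariant zeros; and the eigenvalues observable from $\epsilon_i$ are exactly $\{\lambda_{i,j}\}_{j=1,\ldots,\nu_i}$, the unobservable ones are $\{\lambda_{0,j}\}_{j=1,\ldots,\nu_0}$. Solvable means such $F,G$ exist. Subspaces, for real $\lambda$: $\mathcal R(\lambda)=\{v\in\mathbb R^n\mid\exists w\in\mathbb R^m:\ (A-\lambda I)v+Bw=0,\ Cv+Dw=0\}$; $\mathcal R_i(\lambda)=\{v\in\mathbb R^n\mid\exists w\in\mathbb R^m:\ (A-\lambda I)v+Bw=0,\ C_{(i)}v+D_{(i)}w=0\}$, where $C_{(i)},D_{(i)}$ are $C,D$ with the $i$-th row removed. *)

theory Defs
  imports
    "HOL-Analysis.Analysis"
    "HOL-Computational_Algebra.Polynomial_Factorial"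
    "HOL-Computational_Algebra.Field_as_Ring"
begin

datatype time_domain = Continuous | Discrete

primrec good_region :: "time_domain \<Rightarrow> complex set" where
  "good_region Continuous = {z. Re z < 0}"
| "good_region Discrete = {z. cmod z < 1}"

text \<open>The point of the complex plane that corresponds to constant signals.\<close>

primrec steady_point :: "time_domain \<Rightarrow> real" where
  "steady_point Continuous = 0"
| "steady_point Discrete = 1"

text \<open>The pencil with blocks \<open>A - s I\<close>, \<open>B\<close>, \<open>C\<close>, \<open>D\<close>, with the real entries embedded by \<open>h\<close>
  into a commutative ring. It is used over the complex numbers (\<open>s\<close> a complex number) and over
  the complex polynomials (\<open>s\<close> the indeterminate).\<close>

definition pencil ::
  "(real \<Rightarrow> 'a::comm_ring_1) \<Rightarrow> 'a \<Rightarrow> real^'n^'n \<Rightarrow> real^'m^'n \<Rightarrow> real^'n^'p \<Rightarrow> real^'m^'p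
    \<Rightarrow> 'a^('n::finite + 'm::finite)^('n + 'p::finite)"
where
  "pencil h s A B C D = (\<chi> i j.
     case i of
       Inl a \<Rightarrow> (case j of
          Inl b \<Rightarrow> h (A $ a $ b) - (if a = b then s else 0)
        | Inr b \<Rightarrow> h (B $ a $ b))
     | Inr a \<Rightarrow> (case j of
          Inl b \<Rightarrow> h (C $ a $ b)
        | Inr b \<Rightarrow> h (D $ a $ b)))"

definition rank_at ::
  "real^'n^'n \<Rightarrow> real^'m^'n \<Rightarrow> real^'n^'p \<Rightarrow> real^'m^'p \<Rightarrow> complex \<Rightarrow> nat" where
  "rank_at A B C D z = rank (pencil complex_of_real z A B C D)"

definition normal_rank ::
  "real^'n^'n \<Rightarrow> real^'m^'n \<Rightarrow> real^'n^'p \<Rightarrow> real^'m^'p \<Rightarrow> nat" where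
  "normal_rank A B C D = Max (range (rank_at A B C D))"

definition invariant_zeros ::
  "real^'n^'n \<Rightarrow> real^'m^'n \<Rightarrow> real^'n^'p \<Rightarrow> real^'m^'p \<Rightarrow> complex set" where
  "invariant_zeros A B C D = {z. rank_at A B C D z < normal_rank A B C D}"

definition right_invertible ::
  "real^'n^'n \<Rightarrow> real^'m^'n \<Rightarrow> real^'n^'p \<Rightarrow> real^'m^'p \<Rightarrow> bool" where
  "right_invertible A B C D \<longleftrightarrow>
     finite {z. rank_at A B C D z \<noteq> CARD('n::finite) + CARD('p::finite)}"

text \<open>The minor with row set \<open>R\<close> and column set \<open>c ` R\<close> (up to sign, which depends on the
  bijection \<open>c\<close> from \<open>R\<close> to the columns), by the Leibniz formula.\<close>

definition matrix_minor ::
  "'a::comm_ring_1^'j::finite^'i::finite \<Rightarrow> 'i set \<Rightarrow> ('i \<Rightarrow> 'j) \<Rightarrow> 'a" where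
  "matrix_minor M R c =
     (\<Sum>\<pi> | \<pi> permutes R. of_int (sign \<pi>) * (\<Prod>i\<in>R. M $ i $ c (\<pi> i)))"

text \<open>The zero polynomial is the monic greatest common divisor of the minors of maximal order
  (the normal rank) of the polynomial pencil, that is, the product of the invariant polynomials
  in its Smith form. The algebraic multiplicity of an invariant zero is its multiplicity as a root
  of the zero polynomial, and the geometric multiplicity is the drop of rank.\<close>

definition zero_polynomial ::
  "real^'n^'n \<Rightarrow> real^'m^'n \<Rightarrow> real^'n^'p \<Rightarrow> real^'m^'p \<Rightarrow> complex poly" where
  "zero_polynomial A B C D =
     Gcd {matrix_minor (pencil (\<lambda>a. [:complex_of_real a:]) [:0, 1:] A B C D) R c | R c.
            card R = normal_rank A B C D \<and> inj_on c R}"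

definition zero_alg_mult ::
  "real^'n^'n \<Rightarrow> real^'m^'n \<Rightarrow> real^'n^'p \<Rightarrow> real^'m^'p \<Rightarrow> complex \<Rightarrow> nat" where
  "zero_alg_mult A B C D z = order z (zero_polynomial A B C D)"

definition zero_geom_mult ::
  "real^'n^'n \<Rightarrow> real^'m^'n \<Rightarrow> real^'n^'p \<Rightarrow> real^'m^'p \<Rightarrow> complex \<Rightarrow> nat" where
  "zero_geom_mult A B C D z = normal_rank A B C D - rank_at A B C D z"

definition spectrum :: "real^'n^'n \<Rightarrow> complex set" where
  "spectrum M = {z. \<exists>v. v \<noteq> 0 \<and> map_matrix complex_of_real M *v v = z *s v}"

definition stabilizable :: "time_domain \<Rightarrow> real^'n^'n \<Rightarrow> real^'m^'n \<Rightarrow> bool" where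
  "stabilizable T A B \<longleftrightarrow> (\<exists>F. spectrum (A + B ** F) \<subseteq> good_region T)"

definition ct_solution :: "real^'n^'n \<Rightarrow> real^'n \<Rightarrow> (real \<Rightarrow> real^'n) \<Rightarrow> bool" where
  "ct_solution M b x \<longleftrightarrow>
     (\<forall>t\<ge>0. (x has_vector_derivative (M *v x t + b)) (at t within {0..}))"

definition dt_solution :: "real^'n^'n \<Rightarrow> real^'n \<Rightarrow> (nat \<Rightarrow> real^'n) \<Rightarrow> bool" where
  "dt_solution M b x \<longleftrightarrow> (\<forall>t. x (Suc t) = M *v x t + b)"

text \<open>The static gain is the value at \<open>s = steady_point T\<close> of the closed-loop transfer matrix
  \<open>(C + D F) (s I - A - B F)\<inverse> B + D\<close>.\<close>

definition static_gain ::
  "time_domain \<Rightarrow> real^'n^'n \<Rightarrow> real^'m^'n \<Rightarrow> real^'n^'p \<Rightarrow> real^'m^'p \<Rightarrow> real^'n^'m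
    \<Rightarrow> real^'m^'p"
where
  "static_gain T A B C D F =
     (C + D ** F) ** matrix_inv (mat (steady_point T) - (A + B ** F)) ** B + D"

definition tracks_constants ::
  "time_domain \<Rightarrow> real^'n^'n \<Rightarrow> real^'m^'n \<Rightarrow> real^'n^'p \<Rightarrow> real^'m^'p \<Rightarrow> real^'n^'m
    \<Rightarrow> real^'p^'m \<Rightarrow> bool"
where
  "tracks_constants T A B C D F G \<longleftrightarrow> (\<forall>r.
     case T of
       Continuous \<Rightarrow> (\<forall>x. ct_solution (A + B ** F) (B *v (G *v r)) x \<longrightarrow>
         ((\<lambda>t. C *v x t + D *v (F *v x t + G *v r)) \<longlongrightarrow> r) at_top)
     | Discrete \<Rightarrow> (\<forall>x. dt_solution (A + B ** F) (B *v (G *v r)) x \<longrightarrow>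
         (\<lambda>t. C *v x t + D *v (F *v x t + G *v r)) \<longlonglongrightarrow> r))"

text \<open>Multi-indices \<open>(k, j)\<close>: \<open>k = Some i\<close> refers to output \<open>i\<close>, while \<open>k = None\<close> plays the
  role of the index \<open>0\<close> of the unobservable modes.\<close>

definition mode_index :: "('p option \<Rightarrow> nat) \<Rightarrow> ('p option \<times> nat) set" where
  "mode_index \<nu> = {(k, j). j \<in> {1..\<nu> k}}"

text \<open>State-to-output decoupling with modes \<open>lam (Some i) j\<close>: along every solution of the error
  dynamics each \<open>\<epsilon>\<^sub>i\<close> is a combination of its own modes, and all coefficients \<open>\<beta>\<close> (simultaneously for
  all outputs) are reached by some initial condition.\<close>

definition state_to_output_decoupled ::
  "time_domain \<Rightarrow> real^'n^'n \<Rightarrow> real^'m^'n \<Rightarrow> real^'n^'p \<Rightarrow> real^'m^'p \<Rightarrow> real^'n^'m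
    \<Rightarrow> ('p option \<Rightarrow> nat) \<Rightarrow> ('p option \<Rightarrow> nat \<Rightarrow> real) \<Rightarrow> bool"
where
  "state_to_output_decoupled T A B C D F \<nu> lam \<longleftrightarrow>
     (case T of
       Continuous \<Rightarrow>
         (\<forall>\<xi>. ct_solution (A + B ** F) 0 \<xi> \<longrightarrow>
           (\<exists>\<beta>. \<forall>t\<ge>0. \<forall>i. ((C + D ** F) *v \<xi> t) $ i =
              (\<Sum>j\<in>{1..\<nu> (Some i)}. \<beta> i j * exp (lam (Some i) j * t)))) \<and>
         (\<forall>\<beta>. \<exists>\<xi>. ct_solution (A + B ** F) 0 \<xi> \<and>
           (\<forall>t\<ge>0. \<forall>i. ((C + D ** F) *v \<xi> t) $ i =
              (\<Sum>j\<in>{1..\<nu> (Some i)}. \<beta> i j * exp (lam (Some i) j * t))))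
     | Discrete \<Rightarrow>
         (\<forall>\<xi>. dt_solution (A + B ** F) 0 \<xi> \<longrightarrow>
           (\<exists>\<beta>. \<forall>t. \<forall>i. ((C + D ** F) *v \<xi> t) $ i =
              (\<Sum>j\<in>{1..\<nu> (Some i)}. \<beta> i j * lam (Some i) j ^ t))) \<and>
         (\<forall>\<beta>. \<exists>\<xi>. dt_solution (A + B ** F) 0 \<xi> \<and>
           (\<forall>t. \<forall>i. ((C + D ** F) *v \<xi> t) $ i =
              (\<Sum>j\<in>{1..\<nu> (Some i)}. \<beta> i j * lam (Some i) j ^ t))))"

text \<open>\<open>A + B F\<close> has an eigenbasis realising the eigenvalues \<open>lam (Some i) j\<close> as those observable from
  \<open>\<epsilon>\<^sub>i\<close> and the eigenvalues \<open>lam None j\<close> as the unobservable ones, with multiplicities.\<close>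

definition assigns_modes ::
  "real^'n^'n \<Rightarrow> real^'m^'n \<Rightarrow> real^'n^'p \<Rightarrow> real^'m^'p \<Rightarrow> real^'n^'m
    \<Rightarrow> ('p option \<Rightarrow> nat) \<Rightarrow> ('p option \<Rightarrow> nat \<Rightarrow> real) \<Rightarrow> bool"
where
  "assigns_modes A B C D F \<nu> lam \<longleftrightarrow> (\<exists>v.
     inj_on v (mode_index \<nu>) \<and> independent (v ` mode_index \<nu>) \<and>
     span (v ` mode_index \<nu>) = UNIV \<and>
     (\<forall>(k, j)\<in>mode_index \<nu>.
        (A + B ** F) *v v (k, j) = lam k j *\<^sub>R v (k, j) \<and>
        (case k of
           None \<Rightarrow> (C + D ** F) *v v (k, j) = 0
         | Some i \<Rightarrow> (\<exists>c. c \<noteq> 0 \<and> (C + D ** F) *v v (k, j) = c *\<^sub>R axis i 1))))"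

definition problem_1A_solvable ::
  "time_domain \<Rightarrow> real^'n^'n \<Rightarrow> real^'m^'n \<Rightarrow> real^'n^'p \<Rightarrow> real^'m^'p
    \<Rightarrow> ('p option \<Rightarrow> nat) \<Rightarrow> ('p option \<Rightarrow> nat \<Rightarrow> real) \<Rightarrow> bool"
where
  "problem_1A_solvable T A B C D \<nu> lam \<longleftrightarrow> (\<exists>F G.
     spectrum (A + B ** F) \<subseteq> good_region T \<and>
     static_gain T A B C D F ** G = mat 1 \<and>
     tracks_constants T A B C D F G \<and>
     state_to_output_decoupled T A B C D F \<nu> lam \<and>
     assigns_modes A B C D F \<nu> lam \<and>
     (\<forall>i. \<forall>j\<in>{1..\<nu> (Some i)}. complex_of_real (lam (Some i) j) \<notin> invariant_zeros A B C D))"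

text \<open>\<open>mode_subspace A B C D None\<close> is \<open>\<R>\<close>, and \<open>mode_subspace A B C D (Some i)\<close> is \<open>\<R>\<^sub>i\<close>:
  deleting the \<open>i\<close>-th row of \<open>C\<close> and \<open>D\<close> drops the \<open>i\<close>-th output equation.\<close>

definition mode_subspace ::
  "real^'n^'n \<Rightarrow> real^'m^'n \<Rightarrow> real^'n^'p \<Rightarrow> real^'m^'p \<Rightarrow> 'p option \<Rightarrow> real
    \<Rightarrow> (real^'n) set"
where
  "mode_subspace A B C D k l = {v. \<exists>w. (A - mat l) *v v + B *v w = 0 \<and>
     (\<forall>q. k \<noteq> Some q \<longrightarrow> (C *v v + D *v w) $ q = 0)}"

definition subspace_sum :: "('i \<Rightarrow> 'v::real_vector set) \<Rightarrow> 'i set \<Rightarrow> 'v set" where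
  "subspace_sum V P = {\<Sum>q\<in>P. x q | x. \<forall>q\<in>P. x q \<in> V q}"

end

theory Submission
  imports Defs
begin

text \<open>An eigenvector \<open>v\<close> of \<open>A + B F\<close> with the prescribed output direction lies in \<open>\<R>\<^sub>i(\<lambda>)\<close> with witness
  \<open>w = F v\<close>; conversely, a basis of such vectors together with witnesses \<open>w\<close> determines \<open>F\<close> by
  \<open>F v = w\<close>. So the problem is to choose linearly independent vectors, one from each subspace
  \<open>\<R>\<^sub>i(\<lambda>\<^sub>i\<^sub>,\<^sub>j)\<close>, and the dimension condition is exactly Rado's condition for such an independent
  transversal. Once the closed loop has an eigenbasis, decoupling and tracking are read off in modal
  coordinates, and the static gain is onto because the pencil has full row rank at the steady point.\<close>

section \<open>Rado's theorem\<close>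

text \<open>The dimensions are counted relative to \<open>W\<close>, which replaces passing to a quotient space in the
  induction: a tight subfamily is solved first and its transversal is absorbed into \<open>W\<close>.\<close>

lemma rado_relative:
  fixes S :: "'i \<Rightarrow> 'v::euclidean_space set"
  assumes "finite I"
    and "\<And>P. P \<subseteq> I \<Longrightarrow> dim W + card P \<le> dim (W \<union> \<Union>(S ` P))"
  shows "\<exists>x. (\<forall>q\<in>I. x q \<in> S q) \<and> dim (W \<union> x ` I) = dim W + card I"
  using assms
proof (induction "card I" arbitrary: I W rule: less_induct)
  case less
  note finI = less.prems(1) and rado = less.prems(2)
  show ?case
  proof (cases "\<exists>P. P \<noteq> {} \<and> P \<subset> I \<and> dim (W \<union> \<Union>(S ` P)) = dim W + card P")
    case True
    then obtain P where P: "P \<noteq> {}" "P \<subset> I" and tight: "dim (W \<union> \<Union>(S ` P)) = dim W + card P"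
      by blast
    have finP: "finite P" and PI: "P \<subseteq> I"
      using P finI finite_subset by auto
    have "card P < card I"
      using P finI psubset_card_mono by blast
    then obtain x where x: "\<And>q. q \<in> P \<Longrightarrow> x q \<in> S q" and dx: "dim (W \<union> x ` P) = dim W + card P"
      using less.hyps[of P W] finP rado PI by (meson order_trans)
    \<comment> \<open>The chosen vectors lie in the union over \<open>P\<close>, and tightness makes
      the two dimensions equal, so relative to \<open>W\<close> they already span everything that
      the subfamily offers.\<close>
    have spanP: "span (W \<union> x ` P) = span (W \<union> \<Union>(S ` P))"
      by (rule dim_eq_span) (use x dx tight in auto)
    \<comment> \<open>Rado's condition survives for the remaining indices: apply it to
      \<open>P \<union> Q\<close> and subtract the \<open>card P\<close> dimensions consumed by
      \<open>P\<close>.\<close>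
    have step: "dim (W \<union> x ` P) + card Q \<le> dim ((W \<union> x ` P) \<union> \<Union>(S ` Q))" if "Q \<subseteq> I - P" for Q
    proof -
      have "span ((W \<union> x ` P) \<union> \<Union>(S ` Q)) = span ((W \<union> \<Union>(S ` P)) \<union> \<Union>(S ` Q))"
        using spanP by (simp only: span_Un)
      then have "dim ((W \<union> x ` P) \<union> \<Union>(S ` Q)) = dim ((W \<union> \<Union>(S ` P)) \<union> \<Union>(S ` Q))"
        by (rule span_eq_dim)
      then have "dim ((W \<union> x ` P) \<union> \<Union>(S ` Q)) = dim (W \<union> \<Union>(S ` (P \<union> Q)))"
        by (simp only: UN_Un Un_assoc)
      moreover have "card (P \<union> Q) = card P + card Q"
        using that finP finI by (intro card_Un_disjoint) (auto intro: finite_subset)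
      moreover have "P \<union> Q \<subseteq> I"
        using that PI by blast
      ultimately show ?thesis
        using rado[of "P \<union> Q"] dx by simp
    qed
    have "card (I - P) < card I"
      using P finI by (intro psubset_card_mono) auto
    then obtain y where y: "\<And>q. q \<in> I - P \<Longrightarrow> y q \<in> S q"
      and dy: "dim ((W \<union> x ` P) \<union> y ` (I - P)) = dim (W \<union> x ` P) + card (I - P)"
      using less.hyps[of "I - P" "W \<union> x ` P"] finI step by auto
    define z where "z q = (if q \<in> P then x q else y q)" for q
    have "W \<union> z ` I = (W \<union> x ` P) \<union> y ` (I - P)"
      using PI by (auto simp: z_def)
    moreover have "card I = card P + card (I - P)"
      using finI PI by (metis card_Diff_subset card_mono finP le_add_diff_inverse)
    ultimately have "dim (W \<union> z ` I) = dim W + card I"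
      using dx dy by simp
    moreover have "\<forall>q\<in>I. z q \<in> S q"
      using x y by (auto simp: z_def)
    ultimately show ?thesis
      by blast
  next
    case no_tight: False
    show ?thesis
    proof (cases "I = {}")
      case True
      then show ?thesis by simp
    next
      case False
      then obtain q where q: "q \<in> I" by blast
      \<comment> \<open>The singleton \<open>{q}\<close> demands one dimension beyond those of
        \<open>W\<close>.\<close>
      have "\<not> S q \<subseteq> span W"
      proof
        assume "S q \<subseteq> span W"
        then have "dim (W \<union> S q) \<le> dim W"
          using dim_subset[of "W \<union> S q" "span W"] by (simp add: span_superset)
        then show False
          using rado[of "{q}"] q by simp
      qed
      then obtain a where a: "a \<in> S q" "a \<notin> span W" by blast
      have da: "dim (insert a W) = dim W + 1"
        using a by (simp add: dim_insert)
      \<comment> \<open>Enlarging \<open>W\<close> by \<open>a\<close> costs one dimension. A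
        nonempty \<open>P\<close> that omits \<open>q\<close> is a proper subset of
        \<open>I\<close>, hence not tight, and its strict inequality has this one dimension to
        spare.\<close>
      have step: "dim (insert a W) + card P \<le> dim (insert a W \<union> \<Union>(S ` P))" if "P \<subseteq> I - {q}" for P
      proof (cases "P = {}")
        case True
        then show ?thesis by simp
      next
        case False
        have "P \<subset> I" using that q by blast
        then have "dim (W \<union> \<Union>(S ` P)) \<noteq> dim W + card P" "dim W + card P \<le> dim (W \<union> \<Union>(S ` P))"
          using no_tight False by (blast, intro rado psubset_imp_subset)
        then have "dim W + card P < dim (W \<union> \<Union>(S ` P))"
          by simp
        also have "\<dots> \<le> dim (insert a W \<union> \<Union>(S ` P))"
          by (intro dim_subset) auto
        finally show ?thesis using da by simp
      qed
      have "card (I - {q}) < card I"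
        by (rule card_Diff1_less[OF finI q])
      then obtain y where y: "\<And>r. r \<in> I - {q} \<Longrightarrow> y r \<in> S r"
        and dy: "dim (insert a W \<union> y ` (I - {q})) = dim (insert a W) + card (I - {q})"
        using less.hyps[of "I - {q}" "insert a W"] finI step by auto
      have "insert a W \<union> y ` (I - {q}) = W \<union> (y(q := a)) ` I"
        using q by auto
      moreover have "card I = Suc (card (I - {q}))"
        using q finI by (metis card.remove)
      ultimately have "dim (W \<union> (y(q := a)) ` I) = dim W + card I"
        using dy da by simp
      moreover have "\<forall>r\<in>I. (y(q := a)) r \<in> S r"
        using y a by auto
      ultimately show ?thesis
        by blast
    qed
  qed
qed

text \<open>The case of empty \<open>W\<close>. The sets \<open>S q\<close> are arbitrary rather
  than subspaces, so that sets of admissible vectors can be inserted later. If \<open>card I\<close>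
  indices produce an image of dimension \<open>card I\<close>, no vector is repeated and none
  depends on the others.\<close>

lemma rado:
  fixes S :: "'i \<Rightarrow> 'v::euclidean_space set"
  assumes fin: "finite I"
    and "\<And>P. P \<subseteq> I \<Longrightarrow> card P \<le> dim (\<Union>(S ` P))"
  obtains x where "\<And>q. q \<in> I \<Longrightarrow> x q \<in> S q" "inj_on x I" "independent (x ` I)"
proof -
  obtain x where x: "\<And>q. q \<in> I \<Longrightarrow> x q \<in> S q" and d: "dim (x ` I) = card I"
    using rado_relative[of I "{}" S] assms by auto
  have "card (x ` I) \<le> card I" "dim (x ` I) \<le> card (x ` I)"
    using fin by (auto simp: card_image_le dim_le_card')
  then have c: "card (x ` I) = card I"
    using d by simp
  then have "inj_on x I"
    using fin eq_card_imp_inj_on by blast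
  moreover have "independent (x ` I)"
    using card_eq_dim[of "x ` I" "x ` I"] c d fin by (simp add: span_superset)
  ultimately show thesis
    using x that by blast
qed

section \<open>The pencil away from the invariant zeros\<close>

text \<open>Since \<open>rows M\<close> is a set, equal rows could collapse. The rank is at most
  \<open>card (rows M)\<close>, which is at most \<open>CARD('n)\<close>; equality of the two ends
  makes the rows distinct as well as independent, and independent rows give a right inverse.\<close>

lemma full_row_rank_surj:
  fixes M :: "'a::field^'m^'n"
  assumes "rank M = CARD('n)"
  shows "surj ((*v) M)"
proof -
  have rows: "rows M = (\<lambda>i. row i M) ` UNIV"
    by (auto simp: rows_def)
  have "card (rows M) \<le> CARD('n)" "vec.dim (rows M) \<le> card (rows M)"
    by (auto simp: rows card_image_le vec.dim_le_card')
  then have c: "card (rows M) = CARD('n)" and d: "vec.dim (rows M) = card (rows M)"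
    using assms by (auto simp: row_rank_def_gen)
  have inj: "inj (\<lambda>i. row i M)"
    using c unfolding rows by (intro eq_card_imp_inj_on) auto
  have ind: "vec.independent (rows M)"
    using vec.card_eq_dim[of "rows M" "rows M"] d by (simp add: rows vec.span_superset)
  \<comment> \<open>Coefficients indexed by row numbers are transported to the set
    \<open>rows M\<close> through the inverse of the injective row map.\<close>
  have "\<forall>i. c i = 0" if "(\<Sum>i\<in>UNIV. c i *s row i M) = 0" for c
  proof -
    have "(\<Sum>v\<in>rows M. c (inv (\<lambda>i. row i M) v) *s v) = (\<Sum>i\<in>UNIV. c i *s row i M)"
      unfolding rows by (subst sum.reindex[OF inj]) (simp add: inv_f_f[OF inj])
    then have "\<forall>v\<in>rows M. c (inv (\<lambda>i. row i M) v) = 0"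
      using ind that vec.independentD[of "rows M" "rows M" "\<lambda>v. c (inv (\<lambda>i. row i M) v)"]
      by (auto simp: rows)
    then show ?thesis
      by (auto simp: rows inv_f_f[OF inj])
  qed
  then have "\<exists>N. M ** N = mat 1"
    by (simp add: matrix_right_invertible_independent_rows)
  then show ?thesis
    by (simp add: matrix_right_invertible_surjective)
qed

lemma rank_at_le: "rank_at A B C D z \<le> CARD('n) + CARD('p)"
  for A :: "real^'n^'n" and B :: "real^'m^'n" and C :: "real^'n^'p" and D :: "real^'m^'p"
proof -
  have "rank M \<le> CARD('k)" for M :: "complex^'l^'k"
  proof -
    have rows: "rows M = (\<lambda>i. row i M) ` UNIV"
      by (auto simp: rows_def)
    have "vec.dim (rows M) \<le> card (rows M)" "card (rows M) \<le> CARD('k)"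
      by (auto simp: rows card_image_le vec.dim_le_card')
    then show ?thesis
      by (simp add: row_rank_def_gen)
  qed
  from this[of "pencil complex_of_real z A B C D"] show ?thesis
    by (simp add: rank_at_def)
qed

text \<open>Only finitely many complex numbers have deficient rank, so the bound of
  \<open>rank_at_le\<close> is attained somewhere and is therefore the normal rank.\<close>

lemma rank_at_eq_full:
  fixes A :: "real^'n^'n" and B :: "real^'m^'n" and C :: "real^'n^'p" and D :: "real^'m^'p"
  assumes "right_invertible A B C D" and "z \<notin> invariant_zeros A B C D"
  shows "rank_at A B C D z = CARD('n) + CARD('p)"
proof -
  have "infinite (UNIV :: complex set)"
    by (rule infinite_UNIV_char_0)
  then have "{z. rank_at A B C D z \<noteq> CARD('n) + CARD('p)} \<noteq> UNIV"
    using assms(1) by (auto simp only: right_invertible_def)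
  then obtain s where s: "rank_at A B C D s = CARD('n) + CARD('p)"
    by blast
  have "range (rank_at A B C D) \<subseteq> {..CARD('n) + CARD('p)}"
    using rank_at_le[of A B C D] by blast
  then have "finite (range (rank_at A B C D))"
    by (rule finite_subset) simp
  then have "rank_at A B C D s \<le> normal_rank A B C D"
    unfolding normal_rank_def by (rule Max_ge) simp
  then show ?thesis
    using assms(2) rank_at_le[of A B C D z] s by (simp add: invariant_zeros_def)
qed

text \<open>Full row rank makes the complex pencil onto. For real \<open>l\<close> and a real
  right-hand side, the real part of a complex solution is again a solution.\<close>

lemma pencil_surj:
  fixes A :: "real^'n^'n" and B :: "real^'m^'n" and C :: "real^'n^'p" and D :: "real^'m^'p"
  assumes "right_invertible A B C D" and "complex_of_real l \<notin> invariant_zeros A B C D"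
  obtains v w where "(A - mat l) *v v + B *v w = a" "C *v v + D *v w = b"
proof -
  let ?M = "pencil complex_of_real (complex_of_real l) A B C D"
  have "rank ?M = CARD('n + 'p)"
    using rank_at_eq_full[OF assms] by (simp add: rank_at_def)
  then have "surj ((*v) ?M)"
    by (rule full_row_rank_surj)
  then obtain u where "(\<chi> i. complex_of_real (case i of Inl i \<Rightarrow> a $ i | Inr i \<Rightarrow> b $ i)) = ?M *v u"
    by (rule surjE)
  then have u: "(?M *v u) $ i = complex_of_real (case i of Inl i \<Rightarrow> a $ i | Inr i \<Rightarrow> b $ i)" for i
    by (metis vec_lambda_beta)
  define v :: "real^'n" where "v = (\<chi> i. Re (u $ Inl i))"
  define w :: "real^'m" where "w = (\<chi> i. Re (u $ Inr i))"
  have split: "(\<Sum>j\<in>UNIV. f j) = (\<Sum>j\<in>UNIV. f (Inl j)) + (\<Sum>j\<in>UNIV. f (Inr j))"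
    for f :: "'n + 'm \<Rightarrow> complex"
    by (subst UNIV_Plus_UNIV[symmetric], subst sum.Plus) auto
  have "((A - mat l) *v v + B *v w) $ i = a $ i" for i
    using arg_cong[OF u[of "Inl i"], of Re]
    by (simp add: matrix_vector_mult_def pencil_def split v_def w_def mat_def flip: of_real_diff)
      (simp add: if_distrib if_distribR cong: if_cong)
  moreover have "(C *v v + D *v w) $ i = b $ i" for i
    using arg_cong[OF u[of "Inr i"], of Re]
    by (simp add: matrix_vector_mult_def pencil_def split v_def w_def)
  ultimately show thesis
    using that by (metis vec_eq_iff)
qed

section \<open>Modal coordinates\<close>

lemma mat_mult_vec: "mat s *v x = s *\<^sub>R x" for x :: "real^'n"
  by (simp add: vec_eq_iff matrix_vector_mult_def mat_def if_distrib if_distribR cong: if_cong)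

text \<open>Integrating factor: \<open>f t * exp (- m * t)\<close> has derivative zero on the
  half-line.\<close>

lemma scalar_linear_ode:
  fixes f :: "real \<Rightarrow> real"
  assumes f: "\<And>t. t \<ge> 0 \<Longrightarrow> (f has_real_derivative m * f t) (at t within {0..})"
    and t: "t \<ge> 0"
  shows "f t = f 0 * exp (m * t)"
proof -
  have "\<exists>c. \<forall>t\<in>{0..}. f t * exp (- m * t) = c"
  proof (rule has_field_derivative_zero_constant)
    show "((\<lambda>t. f t * exp (- m * t)) has_real_derivative 0) (at t within {0..})" if "t \<in> {0..}" for t
      by (rule derivative_eq_intros refl f | use that in simp)+
  qed (rule convex_real_interval)
  then obtain c where c: "\<And>t. t \<ge> 0 \<Longrightarrow> f t * exp (- m * t) = c"
    by auto
  have "f t * exp (- m * t) = f 0"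
    using c[of 0] c[OF t] by simp
  then show ?thesis
    by (simp add: exp_minus field_simps)
qed

text \<open>The basis is an indexed family, so that a repeated eigenvalue keeps separate indices;
  injectivity of \<open>v\<close> ties the family to the set on which \<open>representation\<close>
  works.\<close>

locale eigenbasis =
  fixes M :: "real^'n^'n" and I :: "'q set" and v :: "'q \<Rightarrow> real^'n" and \<mu> :: "'q \<Rightarrow> real"
  assumes fin: "finite I" and inj: "inj_on v I" and indep: "independent (v ` I)"
    and spans: "span (v ` I) = UNIV"
    and eig: "\<And>q. q \<in> I \<Longrightarrow> M *v v q = \<mu> q *\<^sub>R v q"
begin

definition coord :: "'q \<Rightarrow> real^'n \<Rightarrow> real" where
  "coord q x = representation (v ` I) x (v q)"

lemma linear_coord: "linear (coord q)"
  unfolding coord_def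
  by (intro linearI) (simp_all add: representation_add representation_scale indep spans)

lemma coord_sum:
  assumes "q \<in> I"
  shows "coord q (\<Sum>r\<in>I. a r *\<^sub>R v r) = a q"
proof -
  have "coord q (v r) = (if r = q then 1 else 0)" if "r \<in> I" for r
    using that assms inj by (auto simp: coord_def representation_basis indep inj_on_eq_iff)
  then have "(\<Sum>r\<in>I. a r * coord q (v r)) = (\<Sum>r\<in>I. if r = q then a r else 0)"
    by (intro sum.cong) auto
  then show ?thesis
    using assms fin by (simp add: linear_sum[OF linear_coord] linear_scale[OF linear_coord])
qed

lemma expansion: "(\<Sum>q\<in>I. coord q x *\<^sub>R v q) = x"
proof -
  have "(\<Sum>b\<in>v ` I. representation (v ` I) x b *\<^sub>R b) = x"
    by (rule sum_representation_eq) (use indep spans fin in auto)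
  then show ?thesis
    by (simp add: sum.reindex[OF inj] coord_def)
qed

lemma mult_sum: "M *v (\<Sum>q\<in>I. a q *\<^sub>R v q) = (\<Sum>q\<in>I. (\<mu> q * a q) *\<^sub>R v q)"
  by (simp add: linear_sum[OF matrix_vector_mul_linear] matrix_vector_mult_scaleR eig mult.commute)

text \<open>This turns each vector equation in \<open>M\<close> into one scalar equation per mode:
  the coordinate functionals are left eigenvectors.\<close>

lemma coord_mult:
  assumes "q \<in> I"
  shows "coord q (M *v x) = \<mu> q * coord q x"
proof -
  have "coord q (M *v x) = coord q (M *v (\<Sum>r\<in>I. coord r x *\<^sub>R v r))"
    by (simp only: expansion)
  also have "\<dots> = \<mu> q * coord q x"
    by (simp only: mult_sum coord_sum[OF assms])
  finally show ?thesis .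
qed

lemma eq_0_if_coord_eq_0: "(\<And>q. q \<in> I \<Longrightarrow> coord q x = 0) \<Longrightarrow> x = 0"
  using expansion[of x] by simp

text \<open>The spectrum is defined through complex eigenvectors while the basis is real. Split an
  eigenvector into real and imaginary parts and choose a mode \<open>q\<close> at which one of them
  has a nonzero coordinate. The two coordinates form a nonzero complex number that
  \<open>\<mu> q\<close> and \<open>z\<close> multiply to the same result.\<close>

lemma spectrum_subset: "spectrum M \<subseteq> complex_of_real ` \<mu> ` I"
proof
  fix z assume "z \<in> spectrum M"
  then obtain u where u: "u \<noteq> 0" "map_matrix complex_of_real M *v u = z *s u"
    by (auto simp: spectrum_def)
  define x :: "real^'n" where "x = (\<chi> i. Re (u $ i))"
  define y :: "real^'n" where "y = (\<chi> i. Im (u $ i))"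
  have u': "(\<Sum>j\<in>UNIV. complex_of_real (M $ i $ j) * u $ j) = z * u $ i" for i
    using arg_cong[OF u(2), of "\<lambda>w. w $ i"] by (simp add: matrix_vector_mult_def map_matrix_def)
  have Mx: "M *v x = Re z *\<^sub>R x - Im z *\<^sub>R y"
    using arg_cong[OF u', of Re] by (simp add: vec_eq_iff matrix_vector_mult_def x_def y_def)
  have My: "M *v y = Im z *\<^sub>R x + Re z *\<^sub>R y"
    using arg_cong[OF u', of Im] by (simp add: vec_eq_iff matrix_vector_mult_def x_def y_def algebra_simps)
  have "x \<noteq> 0 \<or> y \<noteq> 0"
    using u(1) by (auto simp: x_def y_def vec_eq_iff complex_eq_iff)
  then obtain q where q: "q \<in> I" and nz: "coord q x \<noteq> 0 \<or> coord q y \<noteq> 0"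
    using eq_0_if_coord_eq_0 by blast
  have "\<mu> q * coord q x = Re z * coord q x - Im z * coord q y"
    using coord_mult[OF q, of x]
    by (simp add: Mx linear_diff[OF linear_coord] linear_scale[OF linear_coord])
  moreover have "\<mu> q * coord q y = Im z * coord q x + Re z * coord q y"
    using coord_mult[OF q, of y]
    by (simp add: My linear_add[OF linear_coord] linear_scale[OF linear_coord])
  ultimately have "complex_of_real (\<mu> q) * Complex (coord q x) (coord q y)
      = z * Complex (coord q x) (coord q y)"
    by (simp add: complex_eq_iff)
  moreover have "Complex (coord q x) (coord q y) \<noteq> 0"
    using nz by (simp add: complex_eq_iff)
  ultimately show "z \<in> complex_of_real ` \<mu> ` I"
    using q by auto
qed

lemma invertible_shift:
  assumes "s \<notin> \<mu> ` I"
  shows "invertible (mat s - M)"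
proof -
  have "x = 0" if "(mat s - M) *v x = 0" for x
  proof (rule eq_0_if_coord_eq_0)
    fix q assume q: "q \<in> I"
    have "M *v x = s *\<^sub>R x"
      using that by (simp add: matrix_vector_mult_diff_rdistrib mat_mult_vec)
    then have "\<mu> q * coord q x = s * coord q x"
      using coord_mult[OF q, of x] by (auto simp: linear_scale[OF linear_coord])
    moreover have "\<mu> q \<noteq> s"
      using assms q by blast
    ultimately show "coord q x = 0"
      by simp
  qed
  then show ?thesis
    by (simp add: invertible_left_inverse matrix_left_invertible_ker)
qed

text \<open>A coordinate functional is bounded and linear, so it commutes with the derivative and
  each coordinate obeys a scalar equation.\<close>

lemma ct_solution_eq:
  assumes "ct_solution M 0 \<xi>" and t: "t \<ge> 0"
  shows "\<xi> t = (\<Sum>q\<in>I. (coord q (\<xi> 0) * exp (\<mu> q * t)) *\<^sub>R v q)"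
proof -
  have "coord q (\<xi> t) = coord q (\<xi> 0) * exp (\<mu> q * t)" if q: "q \<in> I" for q
  proof (rule scalar_linear_ode[OF _ t])
    fix t :: real assume "t \<ge> 0"
    then have "(\<xi> has_vector_derivative M *v \<xi> t) (at t within {0..})"
      using assms(1) by (simp add: ct_solution_def)
    moreover have "bounded_linear (coord q)"
      using linear_coord by (simp add: linear_conv_bounded_linear)
    ultimately have "((\<lambda>t. coord q (\<xi> t)) has_vector_derivative coord q (M *v \<xi> t)) (at t within {0..})"
      by (rule bounded_linear.has_vector_derivative[rotated])
    then show "((\<lambda>t. coord q (\<xi> t)) has_real_derivative \<mu> q * coord q (\<xi> t)) (at t within {0..})"
      by (simp add: has_real_derivative_iff_has_vector_derivative coord_mult[OF q])
  qed
  then have "(\<Sum>q\<in>I. coord q (\<xi> t) *\<^sub>R v q) = (\<Sum>q\<in>I. (coord q (\<xi> 0) * exp (\<mu> q * t)) *\<^sub>R v q)"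
    by (intro sum.cong) auto
  then show ?thesis
    by (simp only: expansion)
qed

lemma ct_solution_modes: "ct_solution M 0 (\<lambda>t. \<Sum>q\<in>I. (a q * exp (\<mu> q * t)) *\<^sub>R v q)"
  unfolding ct_solution_def
proof (intro allI impI)
  fix t :: real
  have "((\<lambda>t. \<Sum>q\<in>I. (a q * exp (\<mu> q * t)) *\<^sub>R v q) has_vector_derivative
      (\<Sum>q\<in>I. (\<mu> q * (a q * exp (\<mu> q * t))) *\<^sub>R v q)) (at t within {0..})"
    by (auto intro!: derivative_eq_intros has_vector_derivative_sum simp: algebra_simps)
  then show "((\<lambda>t. \<Sum>q\<in>I. (a q * exp (\<mu> q * t)) *\<^sub>R v q) has_vector_derivative
      M *v (\<Sum>q\<in>I. (a q * exp (\<mu> q * t)) *\<^sub>R v q) + 0) (at t within {0..})"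
    by (simp add: mult_sum)
qed

lemma dt_solution_eq:
  assumes "dt_solution M 0 \<xi>"
  shows "\<xi> t = (\<Sum>q\<in>I. (coord q (\<xi> 0) * \<mu> q ^ t) *\<^sub>R v q)"
proof (induction t)
  case 0
  then show ?case by (simp add: expansion)
next
  case (Suc t)
  have "\<xi> (Suc t) = M *v (\<Sum>q\<in>I. (coord q (\<xi> 0) * \<mu> q ^ t) *\<^sub>R v q)"
    using assms by (simp add: dt_solution_def flip: Suc)
  then show ?case
    by (simp add: mult_sum algebra_simps)
qed

lemma dt_solution_modes: "dt_solution M 0 (\<lambda>t. \<Sum>q\<in>I. (a q * \<mu> q ^ t) *\<^sub>R v q)"
  by (simp add: dt_solution_def mult_sum algebra_simps)

lemma ct_solution_tendsto_0:
  assumes \<xi>: "ct_solution M 0 \<xi>" and neg: "\<And>q. q \<in> I \<Longrightarrow> \<mu> q < 0"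
  shows "(\<xi> \<longlongrightarrow> 0) at_top"
proof -
  have "((\<lambda>t. exp (\<mu> q * t)) \<longlongrightarrow> 0) at_top" if "q \<in> I" for q
    by (rule filterlim_compose[OF exp_at_bot])
      (rule filterlim_tendsto_neg_mult_at_bot[OF tendsto_const neg[OF that] filterlim_ident])
  then have "((\<lambda>t. \<Sum>q\<in>I. (coord q (\<xi> 0) * exp (\<mu> q * t)) *\<^sub>R v q) \<longlongrightarrow>
      (\<Sum>q\<in>I. (coord q (\<xi> 0) * 0) *\<^sub>R v q)) at_top"
    by (intro tendsto_intros)
  \<comment> \<open>The modal formula is available only for \<open>t \<ge> 0\<close>, which suffices
    for the limit at infinity.\<close>
  moreover have "\<forall>\<^sub>F t in at_top. (\<Sum>q\<in>I. (coord q (\<xi> 0) * exp (\<mu> q * t)) *\<^sub>R v q) = \<xi> t"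
    using eventually_ge_at_top[of 0] by eventually_elim (simp add: ct_solution_eq[OF \<xi>])
  ultimately show ?thesis
    by (simp add: tendsto_cong)
qed

lemma dt_solution_tendsto_0:
  assumes \<xi>: "dt_solution M 0 \<xi>" and less_1: "\<And>q. q \<in> I \<Longrightarrow> \<bar>\<mu> q\<bar> < 1"
  shows "\<xi> \<longlonglongrightarrow> 0"
proof -
  have "(\<lambda>t. \<Sum>q\<in>I. (coord q (\<xi> 0) * \<mu> q ^ t) *\<^sub>R v q) \<longlonglongrightarrow>
      (\<Sum>q\<in>I. (coord q (\<xi> 0) * 0) *\<^sub>R v q)"
    by (intro tendsto_intros) (simp add: less_1)
  then show ?thesis
    by (simp flip: dt_solution_eq[OF \<xi>])
qed

end

section \<open>Static gain, tracking and decoupling\<close>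

text \<open>Evaluates the gain without computing the inverse: the hypothesis on \<open>x\<close>
  says, in both time domains, that \<open>x\<close> is an equilibrium under the constant input
  \<open>u\<close>, and the gain returns its output.\<close>

lemma static_gain_mult:
  fixes A :: "real^'n^'n" and B :: "real^'m^'n" and C :: "real^'n^'p" and D :: "real^'m^'p"
  assumes inv: "invertible (mat (steady_point T) - (A + B ** F))"
    and x: "steady_point T *\<^sub>R x = (A + B ** F) *v x + B *v u"
  shows "static_gain T A B C D F *v u = (C + D ** F) *v x + D *v u"
proof -
  let ?N = "mat (steady_point T) - (A + B ** F)"
  have "?N *v x = B *v u"
    using x by (simp add: matrix_vector_mult_diff_rdistrib mat_mult_vec)
  then have "matrix_inv ?N *v (B *v u) = (matrix_inv ?N ** ?N) *v x"
    by (simp flip: matrix_vector_mul_assoc)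
  also have "matrix_inv ?N ** ?N = mat 1"
    using inv unfolding matrix_inv_def invertible_def by (rule someI2_ex) simp
  finally show ?thesis
    by (simp add: static_gain_def matrix_vector_mult_add_rdistrib flip: matrix_vector_mul_assoc)
qed

lemma static_gain_right_inverse:
  fixes A :: "real^'n^'n" and B :: "real^'m^'n" and C :: "real^'n^'p" and D :: "real^'m^'p"
  assumes inv: "invertible (mat (steady_point T) - (A + B ** F))"
    and surj: "\<And>b. \<exists>x w. (A - mat (steady_point T)) *v x + B *v w = 0 \<and> C *v x + D *v w = b"
  shows "\<exists>G. static_gain T A B C D F ** G = mat 1"
proof -
  have "\<exists>u. b = static_gain T A B C D F *v u" for b
  proof -
    obtain x w where x: "(A - mat (steady_point T)) *v x + B *v w = 0" and b: "C *v x + D *v w = b"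
      using surj by blast
    \<comment> \<open>The external input \<open>w - F *v x\<close> together with the feedback
      \<open>F *v x\<close> gives the total input \<open>w\<close>, so \<open>x\<close> is a
      closed-loop equilibrium with output \<open>b\<close>.\<close>
    have "static_gain T A B C D F *v (w - F *v x) = (C + D ** F) *v x + D *v (w - F *v x)"
      using x by (intro static_gain_mult[OF inv])
        (simp add: algebra_simps mat_mult_vec flip: matrix_vector_mul_assoc)
    also have "\<dots> = b"
      using b by (simp add: algebra_simps flip: matrix_vector_mul_assoc)
    finally show ?thesis by metis
  qed
  then show ?thesis
    unfolding matrix_right_invertible_surjective surj_def by blast
qed

lemma finite_mode_index: "finite (mode_index \<nu>)" for \<nu> :: "'p::finite option \<Rightarrow> nat"
proof -
  have "mode_index \<nu> = Sigma UNIV (\<lambda>k. {1..\<nu> k})"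
    by (auto simp: mode_index_def)
  then show ?thesis
    by simp
qed

lemma card_mode_index: "card (mode_index \<nu>) = \<nu> None + (\<Sum>i\<in>UNIV. \<nu> (Some i))"
  for \<nu> :: "'p::finite option \<Rightarrow> nat"
proof -
  have "mode_index \<nu> = Sigma UNIV (\<lambda>k. {1..\<nu> k})"
    by (auto simp: mode_index_def)
  then have "card (mode_index \<nu>) = (\<Sum>k\<in>UNIV. \<nu> k)"
    by simp
  then show ?thesis
    by (simp add: UNIV_option_conv sum.reindex)
qed

text \<open>A mode belonging to another output points along a different canonical vector, and an
  unobservable mode is annihilated by \<open>E\<close>; only the modes of output \<open>i\<close>
  remain.\<close>

lemma output_component:
  fixes E :: "real^'n^'p" and \<nu> :: "'p option \<Rightarrow> nat"
  assumes unobs: "\<And>j. j \<in> {1..\<nu> None} \<Longrightarrow> E *v v (None, j) = 0"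
    and obs: "\<And>i j. j \<in> {1..\<nu> (Some i)} \<Longrightarrow> E *v v (Some i, j) = \<gamma> i j *\<^sub>R axis i 1"
  shows "(E *v (\<Sum>q\<in>mode_index \<nu>. a q *\<^sub>R v q)) $ i
    = (\<Sum>j\<in>{1..\<nu> (Some i)}. a (Some i, j) * \<gamma> i j)"
proof -
  have "(E *v (\<Sum>q\<in>mode_index \<nu>. a q *\<^sub>R v q)) $ i = (\<Sum>q\<in>mode_index \<nu>. a q * (E *v v q) $ i)"
    by (simp add: linear_sum[OF matrix_vector_mul_linear] matrix_vector_mult_scaleR)
  also have "\<dots> = (\<Sum>q\<in>Pair (Some i) ` {1..\<nu> (Some i)}. a q * (E *v v q) $ i)"
  proof (rule sum.mono_neutral_right[OF finite_mode_index])
    show "Pair (Some i) ` {1..\<nu> (Some i)} \<subseteq> mode_index \<nu>"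
      by (auto simp: mode_index_def)
    show "\<forall>q\<in>mode_index \<nu> - Pair (Some i) ` {1..\<nu> (Some i)}. a q * (E *v v q) $ i = 0"
    proof
      fix q assume q: "q \<in> mode_index \<nu> - Pair (Some i) ` {1..\<nu> (Some i)}"
      obtain k j where kj: "q = (k, j)" by fastforce
      show "a q * (E *v v q) $ i = 0"
      proof (cases k)
        case None
        then show ?thesis using q kj unobs by (simp add: mode_index_def)
      next
        case (Some i')
        then have "i' \<noteq> i" "E *v v q = \<gamma> i' j *\<^sub>R axis i' 1"
          using q kj obs by (auto simp: mode_index_def)
        then show ?thesis by (simp add: axis_def)
      qed
    qed
  qed
  also have "\<dots> = (\<Sum>j\<in>{1..\<nu> (Some i)}. a (Some i, j) * \<gamma> i j)"
    by (subst sum.reindex) (auto simp: inj_on_def obs intro!: sum.cong)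
  finally show ?thesis .
qed

context eigenbasis
begin

text \<open>Zero lies on the boundary of the open left half-plane, and one on the boundary of the
  open unit disc.\<close>

lemma steady_point_not_mode:
  assumes "\<And>q. q \<in> I \<Longrightarrow> complex_of_real (\<mu> q) \<in> good_region T"
  shows "steady_point T \<notin> \<mu> ` I"
  using assms by (cases T) force+

text \<open>Subtract the equilibrium \<open>xs\<close> that belongs to the constant input
  \<open>G *v r\<close>. Its output is the static gain applied to \<open>G *v r\<close>, which is
  \<open>r\<close>, and the deviation from it solves the homogeneous stable system.\<close>

lemma tracks_constants_if_right_inverse:
  fixes A :: "real^'n^'n" and B :: "real^'m^'n" and C :: "real^'n^'p" and D :: "real^'m^'p"
  assumes M: "M = A + B ** F"
    and stable: "\<And>q. q \<in> I \<Longrightarrow> complex_of_real (\<mu> q) \<in> good_region T"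
    and gain: "static_gain T A B C D F ** G = mat 1"
  shows "tracks_constants T A B C D F G"
proof -
  let ?E = "C + D ** F"
  have inv: "invertible (mat (steady_point T) - M)"
    by (rule invertible_shift, rule steady_point_not_mode) (rule stable)
  have "\<exists>xs. steady_point T *\<^sub>R xs = M *v xs + B *v (G *v r) \<and>
      (\<forall>x. C *v x + D *v (F *v x + G *v r) = ?E *v (x - xs) + r)" for r
  proof -
    obtain N where N: "(mat (steady_point T) - M) ** N = mat 1"
      using inv by (auto simp: invertible_def)
    define xs where "xs = N *v (B *v (G *v r))"
    have "(mat (steady_point T) - M) *v xs = B *v (G *v r)"
      by (simp only: xs_def matrix_vector_mul_assoc[of _ N] N matrix_vector_mul_lid)
    then have xs: "steady_point T *\<^sub>R xs = M *v xs + B *v (G *v r)"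
      by (simp add: matrix_vector_mult_diff_rdistrib mat_mult_vec algebra_simps)
    have "?E *v xs + D *v (G *v r) = static_gain T A B C D F *v (G *v r)"
      using static_gain_mult[of T A B F xs "G *v r" C D] inv xs by (simp add: M)
    also have "\<dots> = r"
      by (simp add: matrix_vector_mul_assoc gain)
    finally have "?E *v xs + D *v (G *v r) = r" .
    then have "C *v x + D *v (F *v x + G *v r) = ?E *v (x - xs) + r" for x
      by (simp add: algebra_simps flip: matrix_vector_mul_assoc)
    then show ?thesis
      using xs by blast
  qed
  then obtain xs where xs: "\<And>r. steady_point T *\<^sub>R xs r = M *v xs r + B *v (G *v r)"
    and out: "\<And>r x. C *v x + D *v (F *v x + G *v r) = ?E *v (x - xs r) + r"
    by metis
  \<comment> \<open>The filter is left general so that one argument serves real time and integer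
    time.\<close>
  have lim: "((\<lambda>t. ?E *v (x t - xs r) + r) \<longlongrightarrow> r) \<F>"
    if "((\<lambda>t. x t - xs r) \<longlongrightarrow> 0) \<F>" for x r and \<F> :: "'t filter"
  proof -
    have "((\<lambda>t. ?E *v (x t - xs r) + r) \<longlongrightarrow> ?E *v 0 + r) \<F>"
      by (intro tendsto_add tendsto_const bounded_linear.tendsto[OF matrix_vector_mul_bounded_linear] that)
    then show ?thesis by simp
  qed
  show ?thesis
  proof (cases T)
    case Continuous
    have "((\<lambda>t. x t - xs r) \<longlongrightarrow> 0) at_top" if "ct_solution M (B *v (G *v r)) x" for x r
    proof (rule ct_solution_tendsto_0)
      \<comment> \<open>In continuous time an equilibrium has zero derivative, so it drops out of
        the equation for the deviation.\<close>
      have "M *v xs r + B *v (G *v r) = 0"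
        using xs[of r] Continuous by simp
      then have "M *v (x t - xs r) = M *v x t + B *v (G *v r)" for t
        by (simp add: algebra_simps eq_neg_iff_add_eq_0)
      then show "ct_solution M 0 (\<lambda>t. x t - xs r)"
        using that by (auto simp: ct_solution_def intro!: derivative_eq_intros)
      show "\<mu> q < 0" if "q \<in> I" for q
        using stable[OF that] Continuous by simp
    qed
    then show ?thesis
      using Continuous by (auto simp: tracks_constants_def out M intro!: lim)
  next
    case Discrete
    have "(\<lambda>t. x t - xs r) \<longlonglongrightarrow> 0" if "dt_solution M (B *v (G *v r)) x" for x r
    proof (rule dt_solution_tendsto_0)
      \<comment> \<open>In discrete time an equilibrium is a fixed point of the update.\<close>
      have "M *v xs r + B *v (G *v r) = xs r"
        using xs[of r] Discrete by simp
      then have "M *v (x t - xs r) = M *v x t + B *v (G *v r) - xs r" for t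
        by (simp add: algebra_simps)
      then show "dt_solution M 0 (\<lambda>t. x t - xs r)"
        using that by (simp add: dt_solution_def)
      show "\<bar>\<mu> q\<bar> < 1" if "q \<in> I" for q
        using stable[OF that] Discrete by simp
    qed
    then show ?thesis
      using Discrete by (auto simp: tracks_constants_def out M intro!: lim)
  qed
qed

end

lemma decoupled_if_assigns_modes:
  fixes A :: "real^'n^'n" and B :: "real^'m^'n" and C :: "real^'n^'p" and D :: "real^'m^'p"
    and \<nu> :: "'p option \<Rightarrow> nat"
  assumes eb: "eigenbasis (A + B ** F) (mode_index \<nu>) v (\<lambda>(k, j). lam k j)"
    and unobs: "\<And>j. j \<in> {1..\<nu> None} \<Longrightarrow> (C + D ** F) *v v (None, j) = 0"
    and obs: "\<And>i j. j \<in> {1..\<nu> (Some i)} \<Longrightarrow> (C + D ** F) *v v (Some i, j) = \<gamma> i j *\<^sub>R axis i 1"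
    and nz: "\<And>i j. j \<in> {1..\<nu> (Some i)} \<Longrightarrow> \<gamma> i j \<noteq> 0"
  shows "state_to_output_decoupled T A B C D F \<nu> lam"
proof -
  interpret eigenbasis "A + B ** F" "mode_index \<nu>" v "\<lambda>(k, j). lam k j"
    by (rule eb)
  \<comment> \<open>Initial modal coordinates that realise prescribed coefficients
    \<open>\<beta>\<close>: divide by the output gain \<open>\<gamma> i j\<close> of the mode.
    Unobservable modes do not reach the output, so they may start at 0.\<close>
  define a where "a \<beta> = (\<lambda>(k, j). case k of None \<Rightarrow> 0 | Some i \<Rightarrow> \<beta> i j / \<gamma> i j)"
    for \<beta> :: "'p \<Rightarrow> nat \<Rightarrow> real"
  have out: "((C + D ** F) *v (\<Sum>q\<in>mode_index \<nu>. b q *\<^sub>R v q)) $ i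
      = (\<Sum>j\<in>{1..\<nu> (Some i)}. b (Some i, j) * \<gamma> i j)" for b i
    by (rule output_component) (use unobs obs in auto)
  show ?thesis
  proof (cases T)
    case Continuous
    have "\<exists>\<beta>. \<forall>t\<ge>0. \<forall>i. ((C + D ** F) *v \<xi> t) $ i =
        (\<Sum>j\<in>{1..\<nu> (Some i)}. \<beta> i j * exp (lam (Some i) j * t))"
      if \<xi>: "ct_solution (A + B ** F) 0 \<xi>" for \<xi>
    proof (intro exI allI impI)
      fix t :: real and i assume "t \<ge> 0"
      show "((C + D ** F) *v \<xi> t) $ i =
          (\<Sum>j\<in>{1..\<nu> (Some i)}. (coord (Some i, j) (\<xi> 0) * \<gamma> i j) * exp (lam (Some i) j * t))"
        unfolding ct_solution_eq[OF \<xi> \<open>t \<ge> 0\<close>] out by (simp add: mult_ac)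
    qed
    moreover have "\<exists>\<xi>. ct_solution (A + B ** F) 0 \<xi> \<and> (\<forall>t\<ge>0. \<forall>i. ((C + D ** F) *v \<xi> t) $ i =
        (\<Sum>j\<in>{1..\<nu> (Some i)}. \<beta> i j * exp (lam (Some i) j * t)))" for \<beta>
      by (intro exI conjI, rule ct_solution_modes[of "a \<beta>"])
        (auto simp: out a_def nz intro!: sum.cong)
    ultimately show ?thesis
      by (simp add: state_to_output_decoupled_def Continuous)
  next
    case Discrete
    have "\<exists>\<beta>. \<forall>t. \<forall>i. ((C + D ** F) *v \<xi> t) $ i =
        (\<Sum>j\<in>{1..\<nu> (Some i)}. \<beta> i j * lam (Some i) j ^ t)"
      if \<xi>: "dt_solution (A + B ** F) 0 \<xi>" for \<xi>
    proof (intro exI allI)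
      fix t i
      show "((C + D ** F) *v \<xi> t) $ i =
          (\<Sum>j\<in>{1..\<nu> (Some i)}. (coord (Some i, j) (\<xi> 0) * \<gamma> i j) * lam (Some i) j ^ t)"
        by (subst dt_solution_eq[OF \<xi>]) (simp add: out mult_ac)
    qed
    moreover have "\<exists>\<xi>. dt_solution (A + B ** F) 0 \<xi> \<and> (\<forall>t. \<forall>i. ((C + D ** F) *v \<xi> t) $ i =
        (\<Sum>j\<in>{1..\<nu> (Some i)}. \<beta> i j * lam (Some i) j ^ t))" for \<beta>
      by (intro exI conjI, rule dt_solution_modes[of "a \<beta>"])
        (auto simp: out a_def nz intro!: sum.cong)
    ultimately show ?thesis
      by (simp add: state_to_output_decoupled_def Discrete)
  qed
qed

text \<open>Once \<open>F\<close> has the required eigenbasis, only \<open>G\<close> is left to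
  choose, as a right inverse of the static gain.\<close>

lemma solvable_if_assigns_modes:
  fixes A :: "real^'n^'n" and B :: "real^'m^'n" and C :: "real^'n^'p" and D :: "real^'m^'p"
    and \<nu> :: "'p option \<Rightarrow> nat"
  assumes right_inv: "right_invertible A B C D"
    and no_steady_zero: "complex_of_real (steady_point T) \<notin> invariant_zeros A B C D"
    and lam_obs: "\<And>i j. j \<in> {1..\<nu> (Some i)} \<Longrightarrow>
          complex_of_real (lam (Some i) j) \<in> good_region T - invariant_zeros A B C D"
    and lam_unobs: "\<And>j. j \<in> {1..\<nu> None} \<Longrightarrow> complex_of_real (lam None j) \<in> good_region T"
    and assigns: "assigns_modes A B C D F \<nu> lam"
  shows "problem_1A_solvable T A B C D \<nu> lam"
proof -
  obtain v where inj: "inj_on v (mode_index \<nu>)" and indep: "independent (v ` mode_index \<nu>)"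
    and spans: "span (v ` mode_index \<nu>) = UNIV"
    and modes: "\<And>k j. (k, j) \<in> mode_index \<nu> \<Longrightarrow> (A + B ** F) *v v (k, j) = lam k j *\<^sub>R v (k, j) \<and>
        (case k of
           None \<Rightarrow> (C + D ** F) *v v (k, j) = 0
         | Some i \<Rightarrow> (\<exists>c. c \<noteq> 0 \<and> (C + D ** F) *v v (k, j) = c *\<^sub>R axis i 1))"
    using assigns unfolding assigns_modes_def by blast
  interpret eigenbasis "A + B ** F" "mode_index \<nu>" v "\<lambda>(k, j). lam k j"
    by unfold_locales (use inj indep spans modes finite_mode_index in auto)
  have stable: "complex_of_real ((\<lambda>(k, j). lam k j) q) \<in> good_region T" if "q \<in> mode_index \<nu>" for q
    using that lam_obs lam_unobs by (cases q; cases "fst q") (auto simp: mode_index_def)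
  have unobs: "(C + D ** F) *v v (None, j) = 0" if "j \<in> {1..\<nu> None}" for j
    using modes[of None j] that by (simp add: mode_index_def)
  have "\<exists>c. c \<noteq> 0 \<and> (C + D ** F) *v v (Some i, j) = c *\<^sub>R axis i 1" if "j \<in> {1..\<nu> (Some i)}" for i j
    using modes[of "Some i" j] that by (simp add: mode_index_def)
  \<comment> \<open>The factor whose existence is asserted for each mode is the \<open>i\<close>-th
    component of its output, which yields an explicit function of \<open>i\<close> and
    \<open>j\<close>.\<close>
  moreover define \<gamma> where "\<gamma> i j = ((C + D ** F) *v v (Some i, j)) $ i" for i j
  ultimately have \<gamma>: "\<gamma> i j \<noteq> 0 \<and> (C + D ** F) *v v (Some i, j) = \<gamma> i j *\<^sub>R axis i 1"
    if "j \<in> {1..\<nu> (Some i)}" for i j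
    using that by (fastforce simp: axis_def)
  have spec: "spectrum (A + B ** F) \<subseteq> good_region T"
    using spectrum_subset stable by blast
  have "invertible (mat (steady_point T) - (A + B ** F))"
    by (rule invertible_shift, rule steady_point_not_mode) (rule stable)
  moreover have "\<exists>x w. (A - mat (steady_point T)) *v x + B *v w = 0 \<and> C *v x + D *v w = b" for b
    by (rule pencil_surj[OF right_inv no_steady_zero, of 0 b]) blast
  ultimately obtain G where G: "static_gain T A B C D F ** G = mat 1"
    using static_gain_right_inverse by blast
  have "tracks_constants T A B C D F G"
    by (rule tracks_constants_if_right_inverse[OF refl _ G]) (rule stable)
  moreover have "state_to_output_decoupled T A B C D F \<nu> lam"
    by (rule decoupled_if_assigns_modes[OF eigenbasis_axioms, where \<gamma> = \<gamma>]) (use unobs \<gamma> in auto)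
  ultimately show ?thesis
    unfolding problem_1A_solvable_def using spec G assigns lam_obs by blast
qed

section \<open>Choice of eigenvectors\<close>

text \<open>Necessity: the eigenvectors indexed by \<open>P\<close> are \<open>card P\<close>
  independent vectors, and each lies in its own subspace with witness \<open>F *v v (k, j)\<close>,
  hence in the sum.\<close>

lemma assigns_modes_imp_dim_ge:
  fixes A :: "real^'n^'n" and B :: "real^'m^'n" and C :: "real^'n^'p" and D :: "real^'m^'p"
    and \<nu> :: "'p option \<Rightarrow> nat"
  assumes assigns: "assigns_modes A B C D F \<nu> lam" and P: "P \<subseteq> mode_index \<nu>"
  shows "card P \<le> dim (subspace_sum (\<lambda>(k, j). mode_subspace A B C D k (lam k j)) P)"
proof -
  let ?V = "\<lambda>(k, j). mode_subspace A B C D k (lam k j)"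
  obtain v where inj: "inj_on v (mode_index \<nu>)" and indep: "independent (v ` mode_index \<nu>)"
    and modes: "\<And>k j. (k, j) \<in> mode_index \<nu> \<Longrightarrow> (A + B ** F) *v v (k, j) = lam k j *\<^sub>R v (k, j) \<and>
        (case k of
           None \<Rightarrow> (C + D ** F) *v v (k, j) = 0
         | Some i \<Rightarrow> (\<exists>c. c \<noteq> 0 \<and> (C + D ** F) *v v (k, j) = c *\<^sub>R axis i 1))"
    using assigns unfolding assigns_modes_def by blast
  have finP: "finite P"
    using P finite_mode_index finite_subset by blast
  have "v (k, j) \<in> ?V (k, j)" if "(k, j) \<in> P" for k j
  proof -
    have eig: "(A - mat (lam k j)) *v v (k, j) + B *v (F *v v (k, j)) = 0"
      using modes[of k j] that P
      by (auto simp: matrix_vector_mul_assoc matrix_vector_mult_diff_rdistrib mat_mult_vec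
          matrix_vector_mult_add_rdistrib algebra_simps)
    have "(C *v v (k, j) + D *v (F *v v (k, j))) $ q = ((C + D ** F) *v v (k, j)) $ q" for q
      by (simp add: matrix_vector_mult_add_rdistrib matrix_vector_mul_assoc)
    moreover have "((C + D ** F) *v v (k, j)) $ q = 0" if "k \<noteq> Some q" for q
    proof -
      have "case k of None \<Rightarrow> (C + D ** F) *v v (k, j) = 0
          | Some i \<Rightarrow> (\<exists>c. c \<noteq> 0 \<and> (C + D ** F) *v v (k, j) = c *\<^sub>R axis i 1)"
        using modes[of k j] \<open>(k, j) \<in> P\<close> P by blast
      then show ?thesis
        using that by (auto simp: axis_def split: option.splits)
    qed
    ultimately show ?thesis
      using eig by (auto simp: mode_subspace_def)
  qed
  \<comment> \<open>Filling the other summands with 0 embeds a single subspace into the sum.\<close>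
  moreover have "0 \<in> ?V q" for q
    by (cases q) (auto simp: mode_subspace_def intro: exI[of _ 0])
  ultimately have sub: "v ` P \<subseteq> subspace_sum ?V P"
  proof (clarsimp simp: subspace_sum_def)
    fix k j assume kj: "(k, j) \<in> P" and V: "\<And>k j. (k, j) \<in> P \<Longrightarrow> v (k, j) \<in> mode_subspace A B C D k (lam k j)"
      and 0: "\<And>k j. 0 \<in> mode_subspace A B C D k (lam k j)"
    show "\<exists>x. v (k, j) = sum x P \<and> (\<forall>q\<in>P. x q \<in> ?V q)"
      using kj V 0 finP by (intro exI[of _ "\<lambda>q. if q = (k, j) then v (k, j) else 0"]) (auto simp: sum.delta)
  qed
  have "card P = card (v ` P)"
    using inj P by (metis card_image inj_on_subset)
  also have "\<dots> = dim (v ` P)"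
    using indep P by (metis dim_eq_card_independent image_mono independent_mono)
  also have "\<dots> \<le> dim (subspace_sum ?V P)"
    using sub by (rule dim_subset)
  finally show ?thesis .
qed

text \<open>An eigenvector for \<open>lam (Some i) j\<close> must not only lie in \<open>\<R>\<^sub>i\<close> but also have a nonzero \<open>i\<close>-th
  output. Away from the invariant zeros that output is a nonzero functional, so the admissible
  vectors still span \<open>\<R>\<^sub>i\<close>, and Rado's theorem can be applied to them directly.\<close>

definition admissible ::
  "real^'n^'n \<Rightarrow> real^'m^'n \<Rightarrow> real^'n^'p \<Rightarrow> real^'m^'p \<Rightarrow> 'p option \<Rightarrow> real
    \<Rightarrow> real^'n \<Rightarrow> real^'m \<Rightarrow> bool" where
  "admissible A B C D k l v w \<longleftrightarrow> (A - mat l) *v v + B *v w = 0 \<and>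
     (\<forall>q. k \<noteq> Some q \<longleftrightarrow> (C *v v + D *v w) $ q = 0)"

lemma mode_subspace_subset_span:
  fixes A :: "real^'n^'n" and B :: "real^'m^'n" and C :: "real^'n^'p" and D :: "real^'m^'p"
  assumes right_inv: "right_invertible A B C D"
    and "k \<noteq> None \<Longrightarrow> complex_of_real l \<notin> invariant_zeros A B C D"
  shows "mode_subspace A B C D k l \<subseteq> span {v. \<exists>w. admissible A B C D k l v w}" (is "_ \<subseteq> span ?S")
proof
  fix v assume "v \<in> mode_subspace A B C D k l"
  then obtain w where w: "(A - mat l) *v v + B *v w = 0"
    and out: "\<And>q. k \<noteq> Some q \<Longrightarrow> (C *v v + D *v w) $ q = 0"
    by (auto simp: mode_subspace_def)
  show "v \<in> span ?S"
  proof (cases "\<exists>i. k = Some i \<and> (C *v v + D *v w) $ i = 0")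
    case False
    then have "admissible A B C D k l v w"
      using w out by (auto simp: admissible_def)
    then show ?thesis
      by (intro span_base) blast
  next
    case True
    then obtain i where k: "k = Some i" and "(C *v v + D *v w) $ i = 0"
      by blast
    then have out0: "C *v v + D *v w = 0"
      using out by (simp add: vec_eq_iff) metis
    \<comment> \<open>Here \<open>v\<close> has zero output. Shifting it by a vector whose output is
      exactly the \<open>i\<close>-th canonical vector makes it admissible, so \<open>v\<close> is
      the difference of the admissible vectors \<open>v + v1\<close> and \<open>v1\<close>.\<close>
    obtain v1 w1 where v1: "(A - mat l) *v v1 + B *v w1 = 0" "C *v v1 + D *v w1 = axis i 1"
      using pencil_surj[OF right_inv assms(2), of 0 "axis i 1"] k by blast
    have "admissible A B C D k l v1 w1"
      using v1 by (auto simp: admissible_def k axis_def)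
    moreover have "admissible A B C D k l (v + v1) (w + w1)"
    proof -
      have "(A - mat l) *v (v + v1) + B *v (w + w1)
          = ((A - mat l) *v v + B *v w) + ((A - mat l) *v v1 + B *v w1)"
        "C *v (v + v1) + D *v (w + w1) = (C *v v + D *v w) + (C *v v1 + D *v w1)"
        by (simp_all add: matrix_vector_right_distrib)
      then show ?thesis
        using w v1 out0 by (simp add: admissible_def k axis_def)
    qed
    ultimately have "(v + v1) - v1 \<in> span ?S"
      by (intro span_diff span_base) blast+
    then show ?thesis by simp
  qed
qed

lemma dim_ge_imp_assigns_modes:
  fixes A :: "real^'n^'n" and B :: "real^'m^'n" and C :: "real^'n^'p" and D :: "real^'m^'p"
    and \<nu> :: "'p option \<Rightarrow> nat"
  assumes right_inv: "right_invertible A B C D"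
    and card: "card (mode_index \<nu>) = CARD('n)"
    and lam_obs: "\<And>i j. j \<in> {1..\<nu> (Some i)} \<Longrightarrow>
          complex_of_real (lam (Some i) j) \<notin> invariant_zeros A B C D"
    and dims: "\<And>P. P \<subseteq> mode_index \<nu> \<Longrightarrow>
          card P \<le> dim (subspace_sum (\<lambda>(k, j). mode_subspace A B C D k (lam k j)) P)"
  shows "\<exists>F. assigns_modes A B C D F \<nu> lam"
proof -
  let ?V = "\<lambda>(k, j). mode_subspace A B C D k (lam k j)"
  define S where "S = (\<lambda>(k, j). {v. \<exists>w. admissible A B C D k (lam k j) v w})"
  have V: "?V q \<subseteq> span (S q)" if "q \<in> mode_index \<nu>" for q
    using that by (auto simp: S_def mode_index_def lam_obs
        intro!: subsetD[OF mode_subspace_subset_span[OF right_inv]])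
  have "card P \<le> dim (\<Union>(S ` P))" if P: "P \<subseteq> mode_index \<nu>" for P
  proof -
    \<comment> \<open>The admissible vectors span at least the sum of the subspaces, so the
      dimension hypothesis carries over to the sets \<open>S q\<close>.\<close>
    have "subspace_sum ?V P \<subseteq> span (\<Union>(S ` P))"
    proof
      fix y assume "y \<in> subspace_sum ?V P"
      then obtain x where y: "y = sum x P" and x: "\<And>q. q \<in> P \<Longrightarrow> x q \<in> ?V q"
        unfolding subspace_sum_def by blast
      have "x q \<in> span (\<Union>(S ` P))" if "q \<in> P" for q
        using x[OF that] V[of q] P that span_mono[of "S q" "\<Union>(S ` P)"] by blast
      then show "y \<in> span (\<Union>(S ` P))"
        unfolding y by (rule span_sum)
    qed
    then have "dim (subspace_sum ?V P) \<le> dim (\<Union>(S ` P))"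
      using dim_subset[of "subspace_sum ?V P" "span (\<Union>(S ` P))"] by simp
    then show ?thesis
      using dims[OF P] by simp
  qed
  then obtain v where v: "\<And>q. q \<in> mode_index \<nu> \<Longrightarrow> v q \<in> S q"
    and inj: "inj_on v (mode_index \<nu>)" and indep: "independent (v ` mode_index \<nu>)"
    using rado[OF finite_mode_index, of \<nu> S] by blast
  \<comment> \<open>There are as many independent vectors as the dimension of the state space, so
    they form a basis.\<close>
  have "card (v ` mode_index \<nu>) = dim (UNIV :: (real^'n) set)"
    using card by (simp add: card_image[OF inj])
  then have spans: "span (v ` mode_index \<nu>) = UNIV"
    using card_eq_dim[of "v ` mode_index \<nu>" UNIV] indep finite_mode_index[of \<nu>] by auto
  have "\<forall>q\<in>mode_index \<nu>. \<exists>w. admissible A B C D (fst q) (lam (fst q) (snd q)) (v q) w"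
    using v by (fastforce simp: S_def)
  then obtain w where w: "\<And>q. q \<in> mode_index \<nu> \<Longrightarrow>
      admissible A B C D (fst q) (lam (fst q) (snd q)) (v q) (w q)"
    by metis
  \<comment> \<open>The feedback is the linear map that sends each chosen eigenvector to its input
    witness; \<open>inv_into\<close> recovers the index from the vector.\<close>
  obtain f where f: "linear f" "\<forall>x\<in>v ` mode_index \<nu>. f x = w (inv_into (mode_index \<nu>) v x)"
    using linear_independent_extend[OF indep, of "\<lambda>x. w (inv_into (mode_index \<nu>) v x)"] by auto
  define F where "F = matrix f"
  have F: "F *v v q = w q" if "q \<in> mode_index \<nu>" for q
    using that f inj by (simp add: F_def matrix_works)
  have "(A + B ** F) *v v (k, j) = lam k j *\<^sub>R v (k, j) \<and>
      (case k of
         None \<Rightarrow> (C + D ** F) *v v (k, j) = 0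
       | Some i \<Rightarrow> (\<exists>c. c \<noteq> 0 \<and> (C + D ** F) *v v (k, j) = c *\<^sub>R axis i 1))"
    if kj: "(k, j) \<in> mode_index \<nu>" for k j
  proof -
    have A: "(A - mat (lam k j)) *v v (k, j) + B *v w (k, j) = 0"
      and C: "\<And>q. k \<noteq> Some q \<longleftrightarrow> (C *v v (k, j) + D *v w (k, j)) $ q = 0"
      using w[OF kj] by (simp_all add: admissible_def)
    have "(A + B ** F) *v v (k, j) = lam k j *\<^sub>R v (k, j)"
      using A by (simp add: F[OF kj] matrix_vector_mult_add_rdistrib matrix_vector_mult_diff_rdistrib
          mat_mult_vec algebra_simps flip: matrix_vector_mul_assoc)
    moreover have E: "(C + D ** F) *v v (k, j) = C *v v (k, j) + D *v w (k, j)"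
      by (simp add: F[OF kj] matrix_vector_mult_add_rdistrib flip: matrix_vector_mul_assoc)
    moreover have "C *v v (k, j) + D *v w (k, j)
        = ((C *v v (k, j) + D *v w (k, j)) $ i) *\<^sub>R axis i 1" if "k = Some i" for i
      unfolding vec_eq_iff
    proof
      fix q
      show "(C *v v (k, j) + D *v w (k, j)) $ q
          = (((C *v v (k, j) + D *v w (k, j)) $ i) *\<^sub>R axis i 1) $ q"
        using C[of q] that by (cases "q = i") (auto simp: axis_def)
    qed
    moreover have "C *v v (k, j) + D *v w (k, j) = 0" if "k = None"
      using C that by (simp add: vec_eq_iff)
    ultimately show ?thesis
      using C by (cases k) (simp_all, metis)
  qed
  then have "assigns_modes A B C D F \<nu> lam"
    unfolding assigns_modes_def using inj indep spans by blast
  then show ?thesis ..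
qed

theorem theorem8:
  fixes T :: time_domain
    and A :: "real^'n^'n" and B :: "real^'m^'n" and C :: "real^'n^'p" and D :: "real^'m^'p"
    and \<nu> :: "'p option \<Rightarrow> nat"
    and lam :: "'p option \<Rightarrow> nat \<Rightarrow> real"
  assumes right_inv: "right_invertible A B C D"
    and stab: "stabilizable T A B"
    and no_steady_zero: "complex_of_real (steady_point T) \<notin> invariant_zeros A B C D"
    and multiplicities: "\<And>z. z \<in> invariant_zeros A B C D \<inter> good_region T \<Longrightarrow>
          zero_alg_mult A B C D z = zero_geom_mult A B C D z"
    and real_zeros: "\<And>z. z \<in> invariant_zeros A B C D \<inter> good_region T \<Longrightarrow> z \<in> \<real>"
    and nu_le: "(\<Sum>i\<in>UNIV. \<nu> (Some i)) \<le> CARD('n)"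
    and nu_0: "\<nu> None = CARD('n) - (\<Sum>i\<in>UNIV. \<nu> (Some i))"
    and lam_obs: "\<And>i j. j \<in> {1..\<nu> (Some i)} \<Longrightarrow>
          complex_of_real (lam (Some i) j) \<in> good_region T - invariant_zeros A B C D"
    and lam_unobs: "\<And>j. j \<in> {1..\<nu> None} \<Longrightarrow> complex_of_real (lam None j) \<in> good_region T"
  shows "problem_1A_solvable T A B C D \<nu> lam \<longleftrightarrow>
    (\<forall>P \<in> Pow (mode_index \<nu>).
       dim (subspace_sum (\<lambda>(k, j). mode_subspace A B C D k (lam k j)) P) \<ge> card P)"
proof
  assume "problem_1A_solvable T A B C D \<nu> lam"
  then obtain F where "assigns_modes A B C D F \<nu> lam"
    by (auto simp: problem_1A_solvable_def)
  then show "\<forall>P \<in> Pow (mode_index \<nu>).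
      dim (subspace_sum (\<lambda>(k, j). mode_subspace A B C D k (lam k j)) P) \<ge> card P"
    by (blast intro: assigns_modes_imp_dim_ge)
next
  assume dims: "\<forall>P \<in> Pow (mode_index \<nu>).
      dim (subspace_sum (\<lambda>(k, j). mode_subspace A B C D k (lam k j)) P) \<ge> card P"
  \<comment> \<open>By \<open>nu_le\<close> the natural-number subtraction in \<open>nu_0\<close>
    does not truncate, so the number of modes is exactly the state dimension.\<close>
  have "card (mode_index \<nu>) = CARD('n)"
    using nu_le nu_0 by (simp add: card_mode_index)
  then obtain F where "assigns_modes A B C D F \<nu> lam"
    using dim_ge_imp_assigns_modes[of A B C D \<nu> lam] right_inv lam_obs dims by blast
  then show "problem_1A_solvable T A B C D \<nu> lam"
    using solvable_if_assigns_modes[OF right_inv no_steady_zero] lam_obs lam_unobs by blast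
qed

end
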